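(* Let $k\in\mathbb N$ be fixed and let $X_{K_{1,k}}$ be the number of labeled copies of the star $K_{1,k}$ in $K(n,P)$. The threshold for the appearance of $K_{1,k}$ in $K(n,P)$ is $(\alpha+\beta)^k+(\beta+\gamma)^k=1$; that is, if $(\alpha+\beta)^k+(\beta+\gamma)^k<1$ then a.a.s. $K(n,P)$ contains no copy of $K_{1,k}$, and if $(\alpha+\beta)^k+(\beta+\gamma)^k>1$ then a.a.s. \[X_{K_{1,k}}=(1+o(1))\left((\alpha+\beta)^k+(\beta+\gamma)^k\right)^n .\]
   Context: Let $0<\alpha,\beta,\gamma<1$ be constants not depending on $n$, and $P=\begin{pmatrix}\alpha&\beta\\ \beta&\gamma\end{pmatrix}$ indexed by $\{0,1\}$ ($P_{1,1}=\alpha$, $P_{0,1}=P_{1,0}=\beta$, $P_{0,0}=\gamma$). The stochastic Kronecker graph $K(n,P)$ has vertex set $\mathbb Z_2^n$; writing $u_k$ for the $k$-th digit of $u$, each pair $\{u,v\}$ is an edge with probability $p_{u,v}=\prod_{k=1}^n P_{u_k,v_k}$, independently of all other pairs. A labeled copy of a graph $G$ is an injective map $V(G)\to\mathbb Z_2^n$ mapping every edge of $G$ to an edge of $K(n,P)$. A.a.s. means with probability tending to $1$ as $n\to\infty$. *)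

theory Defs
  imports "HOL-Probability.Probability"
begin

text \<open>A graph is a pair of a vertex set and a set of edges, edges being two-element vertex sets.\<close>

type_synonym 'a graph = "'a set \<times> 'a set set"

definition star_graph :: "nat \<Rightarrow> nat graph" where
  "star_graph k = ({0..k}, {{0, i} | i. i \<in> {1..k}})"

text \<open>Maps are taken extensional, so that each labeled copy is counted exactly once.\<close>

definition labeled_copies :: "'a graph \<Rightarrow> 'b graph \<Rightarrow> ('a \<Rightarrow> 'b) set" where
  "labeled_copies G H =
     {\<phi> \<in> fst G \<rightarrow>\<^sub>E fst H. inj_on \<phi> (fst G) \<and> (\<forall>e\<in>snd G. \<phi> ` e \<in> snd H)}"

definition kron_vertices :: "nat \<Rightarrow> (nat \<Rightarrow> nat) set" where
  "kron_vertices n = {1..n} \<rightarrow>\<^sub>E {0, 1}"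

definition kron_pairs :: "nat \<Rightarrow> (nat \<Rightarrow> nat) set set" where
  "kron_pairs n = {{u, v} | u v. u \<in> kron_vertices n \<and> v \<in> kron_vertices n \<and> u \<noteq> v}"

definition kron_matrix :: "real \<Rightarrow> real \<Rightarrow> real \<Rightarrow> nat \<Rightarrow> nat \<Rightarrow> real" where
  "kron_matrix \<alpha> \<beta> \<gamma> i j =
     (if i = 1 \<and> j = 1 then \<alpha> else if i = 0 \<and> j = 0 then \<gamma> else \<beta>)"

definition kron_prob :: "(nat \<Rightarrow> nat \<Rightarrow> real) \<Rightarrow> nat \<Rightarrow> (nat \<Rightarrow> nat) \<Rightarrow> (nat \<Rightarrow> nat) \<Rightarrow> real" where
  "kron_prob P n u v = (\<Prod>k=1..n. P (u k) (v k))"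

text \<open>The probability attached to an unordered pair; well defined for symmetric \<open>P\<close>,
  see \<open>kron_pair_prob_eq\<close>.\<close>

definition kron_pair_prob :: "(nat \<Rightarrow> nat \<Rightarrow> real) \<Rightarrow> nat \<Rightarrow> (nat \<Rightarrow> nat) set \<Rightarrow> real" where
  "kron_pair_prob P n e = (THE p. \<exists>u v. e = {u, v} \<and> p = kron_prob P n u v)"

definition kronecker_graph :: "nat \<Rightarrow> (nat \<Rightarrow> nat \<Rightarrow> real) \<Rightarrow> (nat \<Rightarrow> nat) graph pmf" where
  "kronecker_graph n P =
     map_pmf (\<lambda>f. (kron_vertices n, {e \<in> kron_pairs n. f e}))
       (Pi_pmf (kron_pairs n) False (\<lambda>e. bernoulli_pmf (kron_pair_prob P n e)))"

definition aas :: "(nat \<Rightarrow> 'a pmf) \<Rightarrow> (nat \<Rightarrow> 'a \<Rightarrow> bool) \<Rightarrow> bool" where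
  "aas M Q \<longleftrightarrow> (\<lambda>n. measure_pmf.prob (M n) {x. Q n x}) \<longlonglongrightarrow> 1"

text \<open>A.a.s. \<open>X n = (1 + o(1)) * f n\<close>: the \<open>o(1)\<close> term is random, and is bounded a.a.s. by a
  deterministic null sequence.\<close>

definition aas_asymp :: "(nat \<Rightarrow> 'a pmf) \<Rightarrow> (nat \<Rightarrow> 'a \<Rightarrow> real) \<Rightarrow> (nat \<Rightarrow> real) \<Rightarrow> bool" where
  "aas_asymp M X f \<longleftrightarrow>
     (\<exists>\<delta>. \<delta> \<longlonglongrightarrow> 0 \<and> aas M (\<lambda>n x. \<exists>\<eta>. \<bar>\<eta>\<bar> \<le> \<delta> n \<and> X n x = (1 + \<eta>) * f n))"

lemma kron_matrix_sym: "kron_matrix \<alpha> \<beta> \<gamma> i j = kron_matrix \<alpha> \<beta> \<gamma> j i"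
  by (auto simp: kron_matrix_def)

lemma kron_pair_prob_eq:
  assumes "\<And>i j. P i j = P j i"
  shows "kron_pair_prob P n {u, v} = kron_prob P n u v"
proof -
  have sym: "kron_prob P n a b = kron_prob P n b a" for a b
    unfolding kron_prob_def by (intro prod.cong refl assms)
  show ?thesis
    unfolding kron_pair_prob_def
    by (rule the_equality) (auto simp: doubleton_eq_iff sym)
qed

lemma finite_kron_pairs: "finite (kron_pairs n)"
proof -
  have "finite (kron_vertices n)"
    unfolding kron_vertices_def by (intro finite_PiE) auto
  then have "finite (Pow (kron_vertices n))" by simp
  moreover have "kron_pairs n \<subseteq> Pow (kron_vertices n)"
    unfolding kron_pairs_def by auto
  ultimately show ?thesis by (rule rev_finite_subset)
qed

end

theory Submission
  imports Defs
begin

text \<open>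
  Let \<open>a = \<alpha> + \<beta>\<close>, \<open>b = \<beta> + \<gamma>\<close> and \<open>S = a ^ k + b ^ k\<close>. The number of stars is the sum over
  all centres \<open>u\<close> of the falling factorial \<open>(deg u)\<^sub>k\<close>. The expected degree of \<open>u\<close> is, up to the
  forbidden loop, \<open>d u = a ^ w * b ^ (n - w)\<close>, where \<open>w\<close> is the number of ones in \<open>u\<close>, and no single
  edge probability at \<open>u\<close> exceeds an exponentially small fraction of \<open>d u\<close>. Hence the expected
  number of stars is \<open>(1 + o(1)) * S ^ n\<close>, and it is at most \<open>S ^ n\<close>; the case \<open>S < 1\<close> is Markov's
  inequality.

  For \<open>S > 1\<close> the variance is \<open>o(S ^ (2 * n))\<close>. Pairs of stars with the same centre contribute
  \<open>O(S ^ n + (a ^ (2 * k) + b ^ (2 * k)) ^ n)\<close>. Stars with distinct centres \<open>u\<close>, \<open>w\<close> are correlated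
  only through the edge \<open>{u, w}\<close>, and contribute \<open>O(T ^ n)\<close> with
  \<open>T = \<alpha> * a ^ (2 * k - 2) + 2 * \<beta> * (a * b) ^ (k - 1) + \<gamma> * b ^ (2 * k - 2)\<close>, which is at most
  \<open>a ^ (2 * k - 1) + b ^ (2 * k - 1) < S ^ 2\<close>.
\<close>

subsection \<open>Independence in product distributions\<close>

lemma expectation_pair_pmf_mult:
  fixes g :: "'a \<Rightarrow> real" and h :: "'b \<Rightarrow> real"
  assumes "finite (set_pmf p)" "finite (set_pmf q)"
  shows "measure_pmf.expectation (pair_pmf p q) (\<lambda>z. g (fst z) * h (snd z)) =
    measure_pmf.expectation p g * measure_pmf.expectation q h"
proof -
  have "measure_pmf.expectation (pair_pmf p q) (\<lambda>z. g (fst z) * h (snd z)) =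
      (\<Sum>z\<in>set_pmf p \<times> set_pmf q. pmf (pair_pmf p q) z * (g (fst z) * h (snd z)))"
    using assms by (subst integral_measure_pmf[of "set_pmf p \<times> set_pmf q"]) auto
  also have "\<dots> = (\<Sum>x\<in>set_pmf p. pmf p x * g x) * (\<Sum>y\<in>set_pmf q. pmf q y * h y)"
    unfolding sum_product sum.cartesian_product
    by (intro sum.cong) (auto simp: pmf_pair)
  also have "\<dots> = measure_pmf.expectation p g * measure_pmf.expectation q h"
    using assms by (simp add: integral_measure_pmf[of "set_pmf p"] integral_measure_pmf[of "set_pmf q"])
  finally show ?thesis .
qed

lemma finite_set_Pi_pmf:
  assumes "finite A" "\<And>x. x \<in> A \<Longrightarrow> finite (set_pmf (p x))"
  shows "finite (set_pmf (Pi_pmf A d p))"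
  using assms by (auto simp: set_Pi_pmf)

text \<open>The product distribution is realised as an independent pair, with coordinates in
  \<open>A \<inter> B\<close> drawn first and those in \<open>A - B\<close> second. Then
  \<open>g\<close> reads only the first component and, since \<open>C\<close> misses
  \<open>B\<close>, \<open>h\<close> reads only the second.\<close>

lemma expectation_Pi_pmf_mult_disjoint:
  fixes g h :: "('a \<Rightarrow> 'b) \<Rightarrow> real"
  assumes A: "finite A" "\<And>x. x \<in> A \<Longrightarrow> finite (set_pmf (p x))"
    and g: "\<And>f f'. (\<And>x. x \<in> B \<Longrightarrow> f x = f' x) \<Longrightarrow> g f = g f'"
    and h: "\<And>f f'. (\<And>x. x \<in> C \<Longrightarrow> f x = f' x) \<Longrightarrow> h f = h f'"
    and BC: "B \<inter> C = {}"
  shows "measure_pmf.expectation (Pi_pmf A d p) (\<lambda>f. g f * h f) =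
    measure_pmf.expectation (Pi_pmf A d p) g * measure_pmf.expectation (Pi_pmf A d p) h"
proof -
  define M1 where "M1 = Pi_pmf (A \<inter> B) d p"
  define M2 where "M2 = Pi_pmf (A - B) d p"
  define J where "J = (\<lambda>z::('a \<Rightarrow> 'b) \<times> ('a \<Rightarrow> 'b). \<lambda>x. if x \<in> A \<inter> B then fst z x else snd z x)"
  have fin: "finite (set_pmf M1)" "finite (set_pmf M2)"
    unfolding M1_def M2_def using A by (auto intro!: finite_set_Pi_pmf)
  have M: "Pi_pmf A d p = map_pmf J (pair_pmf M1 M2)"
  proof -
    have "Pi_pmf A d p = Pi_pmf ((A \<inter> B) \<union> (A - B)) d p" by (simp add: Int_Diff_Un)
    also have "\<dots> = map_pmf J (pair_pmf M1 M2)"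
      unfolding M1_def M2_def J_def case_prod_beta'[symmetric]
      using A by (subst Pi_pmf_union) (auto simp: case_prod_unfold)
    finally show ?thesis .
  qed
  \<comment> \<open>This holds only on the support: at points of \<open>B\<close> outside
    \<open>A\<close> the merged function takes its value from the second component, and agreement
    with the first relies on both being the default \<open>d\<close> there.\<close>
  have gJ: "g (J z) = g (fst z)" if "z \<in> set_pmf (pair_pmf M1 M2)" for z
  proof (rule g)
    fix x assume "x \<in> B"
    moreover have "fst z x = d" "snd z x = d" if "x \<notin> A"
      using \<open>z \<in> _\<close> that A set_Pi_pmf_subset[of "A \<inter> B" d p] set_Pi_pmf_subset[of "A - B" d p]
      by (auto simp: M1_def M2_def)
    ultimately show "J z x = fst z x" by (auto simp: J_def)
  qed
  have hJ: "h (J z) = h (snd z)" for z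
    by (rule h) (use BC in \<open>auto simp: J_def\<close>)
  have "measure_pmf.expectation (Pi_pmf A d p) (\<lambda>f. g f * h f) =
      measure_pmf.expectation (pair_pmf M1 M2) (\<lambda>z. g (fst z) * h (snd z))"
    unfolding M by (auto simp: hJ gJ intro!: integral_cong_AE AE_pmfI)
  also have "\<dots> = measure_pmf.expectation M1 g * measure_pmf.expectation M2 h"
    by (rule expectation_pair_pmf_mult[OF fin])
  also have "measure_pmf.expectation M1 g = measure_pmf.expectation (Pi_pmf A d p) g"
  proof -
    have "measure_pmf.expectation (Pi_pmf A d p) g =
      measure_pmf.expectation (pair_pmf M1 M2) (\<lambda>z. g (fst z))"
      unfolding M integral_map_pmf by (rule integral_cong_AE) (auto simp: gJ intro!: AE_pmfI)
    then show ?thesis by simp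
  qed
  also have "measure_pmf.expectation M2 h = measure_pmf.expectation (Pi_pmf A d p) h"
    unfolding M by (simp add: hJ)
  finally show ?thesis .
qed

subsection \<open>Sums over injective tuples\<close>

text \<open>The sum of \<open>x (v 1) * \<dots> * x (v j)\<close> over all injective \<open>j\<close>-tuples in \<open>W\<close>, that is
  \<open>j!\<close> times the elementary symmetric polynomial of degree \<open>j\<close>.\<close>

fun inj_sum :: "('a \<Rightarrow> 'b::comm_ring_1) \<Rightarrow> nat \<Rightarrow> 'a set \<Rightarrow> 'b" where
  "inj_sum x 0 W = 1"
| "inj_sum x (Suc j) W = (\<Sum>v\<in>W. x v * inj_sum x j (W - {v}))"

lemma inj_sum_cong:
  "(\<And>v. v \<in> W \<Longrightarrow> x v = y v) \<Longrightarrow> inj_sum x j W = inj_sum y j W"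
proof (induction j arbitrary: W)
  case (Suc j)
  then show ?case using Suc.IH[of "W - {v}" for v] by (auto intro!: sum.cong)
qed simp

lemma inj_sum_nonneg:
  fixes x :: "'a \<Rightarrow> real"
  shows "(\<And>v. v \<in> W \<Longrightarrow> 0 \<le> x v) \<Longrightarrow> 0 \<le> inj_sum x j W"
proof (induction j arbitrary: W)
  case (Suc j)
  then show ?case using Suc.IH[of "W - {v}" for v] by (auto intro!: sum_nonneg mult_nonneg_nonneg)
qed simp

text \<open>An injective tuple either avoids \<open>w\<close> or has it in exactly one of
  \<open>Suc j\<close> positions, the rest being an injective \<open>j\<close>-tuple in
  \<open>W\<close>. This isolates the contribution of a single edge in the covariance
  estimate.\<close>

lemma inj_sum_insert:
  assumes "finite W" "w \<notin> W"
  shows "inj_sum x (Suc j) (insert w W) =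
    inj_sum x (Suc j) W + of_nat (Suc j) * x w * inj_sum x j W"
  using assms
proof (induction j arbitrary: W)
  case 0
  then show ?case by simp
next
  case (Suc j)
  have "inj_sum x (Suc (Suc j)) (insert w W) =
      x w * inj_sum x (Suc j) W + (\<Sum>v\<in>W. x v * inj_sum x (Suc j) (insert w W - {v}))"
    using Suc.prems by (simp del: inj_sum.simps(2) add: inj_sum.simps(2)[of x "Suc j"])
  also have "(\<Sum>v\<in>W. x v * inj_sum x (Suc j) (insert w W - {v})) =
     (\<Sum>v\<in>W. x v * inj_sum x (Suc j) (W - {v}) + of_nat (Suc j) * x w * (x v * inj_sum x j (W - {v})))"
  proof (rule sum.cong[OF refl])
    fix v assume v: "v \<in> W"
    then have "insert w W - {v} = insert w (W - {v})" using Suc.prems by auto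
    then show "x v * inj_sum x (Suc j) (insert w W - {v}) = x v * inj_sum x (Suc j) (W - {v}) +
       of_nat (Suc j) * x w * (x v * inj_sum x j (W - {v}))"
      using Suc.IH[of "W - {v}"] Suc.prems by (simp del: inj_sum.simps add: algebra_simps)
  qed
  also have "\<dots> = inj_sum x (Suc (Suc j)) W + of_nat (Suc j) * x w * inj_sum x (Suc j) W"
    unfolding sum.distrib inj_sum.simps(2)[of x "Suc j"]
    by (simp only: inj_sum.simps(2)[of x j] sum_distrib_left)
  finally show ?case by (simp del: inj_sum.simps add: algebra_simps)
qed

text \<open>Dropping injectivity only adds nonnegative terms, and the sum over all
  \<open>j\<close>-tuples is the power.\<close>

lemma inj_sum_le_power:
  fixes x :: "'a \<Rightarrow> real"
  assumes "finite W" "\<And>v. v \<in> W \<Longrightarrow> 0 \<le> x v"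
  shows "inj_sum x j W \<le> sum x W ^ j"
  using assms
proof (induction j arbitrary: W)
  case 0
  then show ?case by simp
next
  case (Suc j)
  have "inj_sum x (Suc j) W \<le> (\<Sum>v\<in>W. x v * sum x W ^ j)"
    unfolding inj_sum.simps
  proof (intro sum_mono mult_left_mono)
    fix v assume v: "v \<in> W"
    show "0 \<le> x v" using Suc.prems v by auto
    have "inj_sum x j (W - {v}) \<le> sum x (W - {v}) ^ j"
      using Suc.prems by (intro Suc.IH) auto
    also have "\<dots> \<le> sum x W ^ j"
      using Suc.prems by (intro power_mono sum_mono2 sum_nonneg) auto
    finally show "inj_sum x j (W - {v}) \<le> sum x W ^ j" .
  qed
  then show ?case by (simp add: sum_distrib_right[symmetric])
qed

text \<open>When the entries are chosen one after another, fewer than \<open>j\<close> are excluded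
  at any time, each of weight at most \<open>m\<close>, so every choice has at least
  \<open>sum x W - real j * m\<close> available. The last hypothesis keeps this base nonnegative, so
  that its powers are monotone.\<close>

lemma inj_sum_ge_power:
  fixes x :: "'a \<Rightarrow> real"
  assumes "finite W" "\<And>v. v \<in> W \<Longrightarrow> 0 \<le> x v" "\<And>v. v \<in> W \<Longrightarrow> x v \<le> m"
    and "0 \<le> m" "real j * m \<le> sum x W"
  shows "(sum x W - real j * m) ^ j \<le> inj_sum x j W"
  using assms
proof (induction j arbitrary: W)
  case 0
  then show ?case by simp
next
  case (Suc j)
  let ?r = "sum x W - real (Suc j) * m"
  have r: "0 \<le> ?r" using Suc.prems by simp
  have "?r ^ Suc j \<le> sum x W * ?r ^ j"
    using r Suc.prems by (auto intro!: mult_right_mono)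
  also have "\<dots> = (\<Sum>v\<in>W. x v * ?r ^ j)" by (simp add: sum_distrib_right)
  also have "\<dots> \<le> inj_sum x (Suc j) W"
    unfolding inj_sum.simps
  proof (intro sum_mono mult_left_mono)
    fix v assume v: "v \<in> W"
    show "0 \<le> x v" using Suc.prems v by auto
    have s: "sum x (W - {v}) = sum x W - x v" using Suc.prems v by (simp add: sum_diff1)
    have xm: "x v \<le> m" using Suc.prems v by auto
    have "?r ^ j \<le> (sum x (W - {v}) - real j * m) ^ j"
      using r xm by (intro power_mono) (auto simp: s algebra_simps)
    also have "\<dots> \<le> inj_sum x j (W - {v})"
      using Suc.prems xm r by (intro Suc.IH) (auto simp: s algebra_simps)
    finally show "?r ^ j \<le> inj_sum x j (W - {v})" .
  qed
  finally show ?case .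
qed

section \<open>Indicator weights and falling factorials\<close>

lemma inj_sum_of_bool:
  assumes "finite W"
  shows "inj_sum (\<lambda>v. of_bool (Q v)) j W = (\<Prod>i<j. of_nat (card {v\<in>W. Q v}) - of_nat i :: 'b::comm_ring_1)"
  using assms
proof (induction j arbitrary: W)
  case 0
  then show ?case by simp
next
  case (Suc j)
  let ?d = "card {v\<in>W. Q v}"
  have "inj_sum (\<lambda>v. of_bool (Q v)) (Suc j) W =
      (\<Sum>v\<in>{v\<in>W. Q v}. inj_sum (\<lambda>v. of_bool (Q v)) j (W - {v}) :: 'b)"
    using Suc.prems by (auto intro!: sum.mono_neutral_cong_right)
  also have "\<dots> = (\<Sum>v\<in>{v\<in>W. Q v}. \<Prod>i<j. of_nat ?d - of_nat (Suc i))"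
  proof (rule sum.cong[OF refl])
    fix v assume v: "v \<in> {v\<in>W. Q v}"
    have "{u \<in> W - {v}. Q u} = {v\<in>W. Q v} - {v}" by auto
    then have "?d = Suc (card {u \<in> W - {v}. Q u})" using v Suc.prems
      by (simp add: card_Suc_Diff1 del: card_Diff_insert)
    then show "inj_sum (\<lambda>v. of_bool (Q v)) j (W - {v}) = (\<Prod>i<j. of_nat ?d - of_nat (Suc i) :: 'b)"
      using Suc.IH[of "W - {v}"] Suc.prems by simp
  qed
  also have "\<dots> = (\<Prod>i<Suc j. of_nat ?d - of_nat i)"
    by (subst prod.lessThan_Suc_shift) simp
  finally show ?case .
qed

text \<open>Truncated subtraction does no harm: as soon as \<open>k > d\<close>, the factor with
  \<open>i = d\<close> vanishes on both sides.\<close>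

lemma of_nat_falling_factorial:
  "of_nat (\<Prod>i<k. d - i) = (\<Prod>i<k. of_nat d - of_nat i :: 'b::comm_ring_1)"
proof (cases "k \<le> d")
  case True
  then show ?thesis by (auto intro!: prod.cong simp: of_nat_diff)
next
  case False
  then have "d \<in> {..<k}" by simp
  then show ?thesis
    by (metis (mono_tags, lifting) finite_lessThan of_nat_0 prod_zero cancel_comm_monoid_add_class.diff_cancel)
qed

text \<open>Only the falling factorials of order \<open>k\<close> and \<open>2 * k\<close> are needed on the right, because
  \<open>d ^ k\<close> is at most \<open>(2 * k) ^ k\<close> or a constant multiple of \<open>(d - k) \<dots> (d - 2 * k + 1)\<close>.\<close>

lemma falling_factorial_square_le:
  fixes d k :: nat
  shows "(\<Prod>i<k. d - i)\<^sup>2 \<le> (2 * k) ^ k * ((\<Prod>i<k. d - i) + (\<Prod>i<2*k. d - i))"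
proof (cases "d < 2 * k")
  case True
  have "(\<Prod>i<k. d - i) \<le> (\<Prod>i<k. 2 * k)" using True by (intro prod_mono) auto
  then have "(\<Prod>i<k. d - i) * (\<Prod>i<k. d - i) \<le> (2 * k) ^ k * (\<Prod>i<k. d - i)"
    by (intro mult_right_mono) auto
  then show ?thesis by (simp only: power2_eq_square add_mult_distrib2 trans_le_add1)
next
  case False
  \<comment> \<open>The comparison is factor by factor. With \<open>d = 2 * k + e\<close> and
    \<open>i < k\<close>, the difference \<open>d - (k + i)\<close> is at least
    \<open>e + 1\<close>, and \<open>2 * k + e\<close> is at most
    \<open>2 * k * (e + 1)\<close>.\<close>
  have "(\<Prod>i<k. d - i) \<le> (\<Prod>i<k. 2 * k * (d - (k + i)))"
  proof (intro prod_mono conjI)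
    fix i assume i: "i \<in> {..<k}"
    then obtain e where e: "d = 2 * k + e" using False by (metis le_Suc_ex not_less)
    obtain l where l: "k = Suc (i + l)" using i by (metis add_Suc less_iff_Suc_add lessThan_iff)
    have "d - i \<le> 2 * k + e" by (simp add: e)
    also have "\<dots> \<le> 2 * k * (e + 1)" using l by simp
    also have "\<dots> \<le> 2 * k * (d - (k + i))" using l by (intro mult_left_mono) (simp_all add: e)
    finally show "d - i \<le> 2 * k * (d - (k + i))" .
  qed simp
  also have "\<dots> = (2 * k) ^ k * (\<Prod>i<k. d - (k + i))" by (simp add: prod.distrib)
  finally have "(\<Prod>i<k. d - i) * (\<Prod>i<k. d - i) \<le>
      (\<Prod>i<k. d - i) * ((2 * k) ^ k * (\<Prod>i<k. d - (k + i)))"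
    by (intro mult_left_mono) auto
  also have "\<dots> = (2 * k) ^ k * (\<Prod>i<2 * k. d - i)"
  proof -
    have "(\<Prod>i<k + k. d - i) = (\<Prod>i<k. d - i) * (\<Prod>i<k. d - (k + i))"
      using prod.atLeastLessThan_concat[of 0 k "k + k" "(-) d"] prod.shift_bounds_nat_ivl[of "(-) d" 0 k k]
      by (simp add: lessThan_atLeast0 add.commute)
    then show ?thesis by (simp add: mult_2)
  qed
  finally show ?thesis by (simp only: power2_eq_square add_mult_distrib2 trans_le_add2)
qed

lemma inj_sum_of_bool_square_le:
  assumes "finite W"
  shows "(inj_sum (\<lambda>v. of_bool (Q v)) k W)\<^sup>2 \<le>
    (2 * real k) ^ k * (inj_sum (\<lambda>v. of_bool (Q v)) k W + inj_sum (\<lambda>v. of_bool (Q v)) (2 * k) W)"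
proof -
  have "real ((\<Prod>i<k. card {v\<in>W. Q v} - i)\<^sup>2) \<le>
      real ((2 * k) ^ k * ((\<Prod>i<k. card {v\<in>W. Q v} - i) + (\<Prod>i<2*k. card {v\<in>W. Q v} - i)))"
    by (subst of_nat_le_iff) (rule falling_factorial_square_le)
  then show ?thesis
    unfolding inj_sum_of_bool[OF assms] of_nat_falling_factorial[symmetric]
    by (simp only: of_nat_mult of_nat_power of_nat_add of_nat_numeral)
qed

text \<open>Copies are sorted by the image \<open>u\<close> of the centre 0; what remains is an
  injective map from the leaves into the neighbourhood of \<open>u\<close>, and these are counted by
  a falling factorial.\<close>

lemma card_star_copies:
  assumes V: "finite V"
  shows "of_nat (card (labeled_copies (star_graph k) (V, E))) =
    (\<Sum>u\<in>V. inj_sum (\<lambda>v. of_bool ({u, v} \<in> E)) k (V - {u}) :: 'b::comm_ring_1)"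
proof -
  define N where "N = (\<lambda>u. {v \<in> V - {u}. {u, v} \<in> E})"
  define F where "F = (\<lambda>u. {\<psi> \<in> {1..k} \<rightarrow>\<^sub>E N u. inj_on \<psi> {1..k}})"
  have NV: "finite (N u)" for u using V by (simp add: N_def)
  have split: "{0..k} = insert 0 {1..k}" by auto
  have "bij_betw (\<lambda>(u, \<psi>). \<psi>(0 := u)) (SIGMA u:V. F u) (labeled_copies (star_graph k) (V, E))"
  \<comment> \<open>The inverse resets the value at 0 to \<open>undefined\<close>, which makes the
    leaf map extensional on \<open>{1..k}\<close>.\<close>
  proof (rule bij_betwI[where g = "\<lambda>\<phi>. (\<phi> 0, \<phi>(0 := undefined))"])
    show "(\<lambda>(u, \<psi>). \<psi>(0 := u)) \<in> (SIGMA u:V. F u) \<rightarrow> labeled_copies (star_graph k) (V, E)"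
    proof (intro funcsetI, clarify)
      fix u \<psi> assume u: "u \<in> V" and \<psi>: "\<psi> \<in> F u"
      have a: "\<psi> i \<in> V" "\<psi> i \<noteq> u" "{u, \<psi> i} \<in> E" if "i \<in> {1..k}" for i
        using \<psi> that by (auto simp: F_def N_def dest!: PiE_mem[of _ _ _ i])
      have "\<psi>(0 := u) \<in> insert 0 {1..k} \<rightarrow>\<^sub>E V"
        using u \<psi> a(1) by (auto simp: F_def PiE_iff extensional_def)
      moreover have "inj_on (\<psi>(0 := u)) (insert 0 {1..k})"
      proof -
        have "inj_on \<psi> {1..k}" using \<psi> by (simp add: F_def)
        then have "inj_on (\<psi>(0 := u)) {1..k}" by (subst inj_on_cong[of _ _ \<psi>]) auto
        moreover have "u \<notin> \<psi> ` {1..k}" using a(2) by blast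
        ultimately show ?thesis by (auto simp: inj_on_insert)
      qed
      moreover have "\<forall>e\<in>{{0, i} | i. i \<in> {1..k}}. (\<psi>(0 := u)) ` e \<in> E"
      proof clarify
        fix i assume i: "i \<in> {1..k}"
        then have "(\<psi>(0 := u)) ` {0, i} = {u, \<psi> i}" by auto
        then show "(\<psi>(0 := u)) ` {0, i} \<in> E" using a(3)[OF i] by simp
      qed
      ultimately show "\<psi>(0 := u) \<in> labeled_copies (star_graph k) (V, E)"
        by (simp only: labeled_copies_def star_graph_def split mem_Collect_eq fst_conv snd_conv simp_thms)
    qed
    show "(\<lambda>\<phi>. (\<phi> 0, \<phi>(0 := undefined))) \<in> labeled_copies (star_graph k) (V, E) \<rightarrow> (SIGMA u:V. F u)"
    proof
      fix \<phi> assume "\<phi> \<in> labeled_copies (star_graph k) (V, E)"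
      then have \<phi>: "\<phi> \<in> {0..k} \<rightarrow>\<^sub>E V" "inj_on \<phi> {0..k}"
        and e: "\<forall>e\<in>{{0, i} | i. i \<in> {1..k}}. \<phi> ` e \<in> E"
        unfolding labeled_copies_def star_graph_def mem_Collect_eq fst_conv snd_conv
        by - (elim conjE, assumption)+
      have "\<phi> i \<in> N (\<phi> 0)" if "i \<in> {1..k}" for i
        using \<phi> bspec[OF e, of "{0, i}"] that inj_onD[OF \<phi>(2), of i 0] by (auto simp: N_def)
      moreover have "inj_on (\<phi>(0 := undefined)) {1..k}"
        using \<phi>(2) by (auto simp: inj_on_def)
      ultimately show "(\<phi> 0, \<phi>(0 := undefined)) \<in> (SIGMA u:V. F u)"
        using \<phi>(1) by (auto simp: F_def PiE_iff extensional_def)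
    qed
    next
    fix z assume "z \<in> (SIGMA u:V. F u)"
    then show "(((case z of (u, \<psi>) \<Rightarrow> \<psi>(0 := u)) 0),
         (case z of (u, \<psi>) \<Rightarrow> \<psi>(0 := u))(0 := undefined)) = z"
      by (auto simp: F_def PiE_iff extensional_def fun_eq_iff)
    next
    fix \<phi> :: "nat \<Rightarrow> 'a"
    show "(case (\<phi> 0, \<phi>(0 := undefined)) of (u, \<psi>) \<Rightarrow> \<psi>(0 := u)) = \<phi>" by auto
  qed
  then have "card (labeled_copies (star_graph k) (V, E)) = card (SIGMA u:V. F u)"
    by (simp add: bij_betw_same_card)
  also have "\<dots> = (\<Sum>u\<in>V. card (F u))"
    using V NV by (intro card_SigmaI) (auto simp: F_def intro!: finite_PiE finite_Collect_conjI)
  also have "\<dots> = (\<Sum>u\<in>V. \<Prod>i<k. card (N u) - i)"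
    unfolding F_def using card_inj_on_subset_funcset[of "{1..k}" "N u" "{1..k}" for u] NV
    by (simp add: lessThan_atLeast0)
  finally have "of_nat (card (labeled_copies (star_graph k) (V, E))) =
      (\<Sum>u\<in>V. \<Prod>i<k. of_nat (card (N u)) - of_nat i :: 'b)"
    by (simp only: of_nat_sum of_nat_falling_factorial)
  also have "\<dots> = (\<Sum>u\<in>V. inj_sum (\<lambda>v. of_bool ({u, v} \<in> E)) k (V - {u}))"
    using V by (simp add: inj_sum_of_bool N_def)
  finally show ?thesis .
qed

subsection \<open>Stars in a graph with independent edges\<close>

locale bernoulli_graph =
  fixes V :: "'a set" and p :: "'a set \<Rightarrow> real"
  assumes finite_V: "finite V"
    and p_nonneg: "\<And>e. 0 \<le> p e" and p_le_1: "\<And>e. p e \<le> 1"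
begin

definition pairs :: "'a set set" where
  "pairs = {{u, v} | u v. u \<in> V \<and> v \<in> V \<and> u \<noteq> v}"

definition edges_pmf :: "('a set \<Rightarrow> bool) pmf" where
  "edges_pmf = Pi_pmf pairs False (\<lambda>e. bernoulli_pmf (p e))"

text \<open>The set \<open>W\<close> of admissible leaves is a parameter so that single vertices can
  be removed: chosen leaves in the induction for the mean, the other centre in the
  covariance.\<close>

definition star_count :: "nat \<Rightarrow> 'a \<Rightarrow> 'a set \<Rightarrow> ('a set \<Rightarrow> bool) \<Rightarrow> real" where
  "star_count k u W f = inj_sum (\<lambda>v. of_bool (f {u, v})) k W"

definition mean_degree :: "'a \<Rightarrow> real" where
  "mean_degree u = (\<Sum>v\<in>V - {u}. p {u, v})"

abbreviation E :: "(('a set \<Rightarrow> bool) \<Rightarrow> real) \<Rightarrow> real" where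
  "E \<equiv> measure_pmf.expectation edges_pmf"

lemma finite_pairs: "finite pairs"
  by (rule finite_subset[of _ "Pow V"]) (auto simp: pairs_def finite_V)

lemma finite_set_edges_pmf: "finite (set_pmf edges_pmf)"
  unfolding edges_pmf_def by (intro finite_set_Pi_pmf finite_pairs) simp

lemma integrable_edges_pmf [simp]: "integrable (measure_pmf edges_pmf) (g :: _ \<Rightarrow> real)"
  by (rule integrable_measure_pmf_finite[OF finite_set_edges_pmf])

lemma expectation_mult_disjoint:
  assumes "\<And>f f'. (\<And>x. x \<in> B \<Longrightarrow> f x = f' x) \<Longrightarrow> g f = g f'"
    and "\<And>f f'. (\<And>x. x \<in> C \<Longrightarrow> f x = f' x) \<Longrightarrow> h f = h f'"
    and "B \<inter> C = {}"
  shows "E (\<lambda>f. g f * h f) = E g * E h"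
  unfolding edges_pmf_def
  by (rule expectation_Pi_pmf_mult_disjoint[OF finite_pairs _ assms]) simp

lemma expectation_edge:
  assumes "e \<in> pairs"
  shows "E (\<lambda>f. of_bool (f e)) = p e"
proof -
  have "E (\<lambda>f. of_bool (f e)) =
      measure_pmf.expectation (map_pmf (\<lambda>f. f e) edges_pmf) of_bool"
    by simp
  also have "map_pmf (\<lambda>f. f e) edges_pmf = bernoulli_pmf (p e)"
    using assms finite_pairs by (simp add: edges_pmf_def Pi_pmf_component)
  finally show ?thesis by (simp add: p_nonneg p_le_1)
qed

lemma star_count_cong:
  "(\<And>e. e \<in> (\<lambda>v. {u, v}) ` W \<Longrightarrow> f e = f' e) \<Longrightarrow> star_count k u W f = star_count k u W f'"
  unfolding star_count_def by (rule inj_sum_cong) auto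

text \<open>Distinct leaves give distinct edges at \<open>u\<close>, so the first edge is
  independent of the star formed by the remaining leaves and can be peeled off.\<close>

lemma expectation_star_count:
  assumes "u \<in> V" "W \<subseteq> V - {u}"
  shows "E (star_count j u W) = inj_sum (\<lambda>v. p {u, v}) j W"
  using assms(2)
proof (induction j arbitrary: W)
  case 0
  then show ?case by (simp add: star_count_def)
next
  case (Suc j)
  have "E (star_count (Suc j) u W) = (\<Sum>v\<in>W. E (\<lambda>f. of_bool (f {u, v}) * star_count j u (W - {v}) f))"
    by (simp add: star_count_def[abs_def])
  also have "\<dots> = (\<Sum>v\<in>W. E (\<lambda>f. of_bool (f {u, v})) * E (star_count j u (W - {v})))"
  proof (intro sum.cong refl)
    fix v assume "v \<in> W"
    show "E (\<lambda>f. of_bool (f {u, v}) * star_count j u (W - {v}) f) =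
        E (\<lambda>f. of_bool (f {u, v})) * E (star_count j u (W - {v}))"
      by (rule expectation_mult_disjoint[where B = "{{u, v}}" and C = "(\<lambda>w. {u, w}) ` (W - {v})"])
        (auto intro: star_count_cong simp: doubleton_eq_iff)
  qed
  also have "\<dots> = inj_sum (\<lambda>v. p {u, v}) (Suc j) W"
    unfolding inj_sum.simps
  proof (intro sum.cong refl arg_cong2[where f = "(*)"])
    fix v assume v: "v \<in> W"
    then have "{u, v} \<in> pairs" using Suc.prems assms(1) by (auto simp: pairs_def)
    then show "E (\<lambda>f. of_bool (f {u, v})) = p {u, v}" by (rule expectation_edge)
    show "E (star_count j u (W - {v})) = inj_sum (\<lambda>v. p {u, v}) j (W - {v})"
      using Suc.prems by (intro Suc.IH) auto
  qed
  finally show ?case .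
qed

lemma mean_degree_nonneg: "0 \<le> mean_degree u"
  by (auto simp: mean_degree_def intro!: sum_nonneg p_nonneg)

lemma expectation_star_count_nonneg:
  assumes "u \<in> V" "W \<subseteq> V - {u}"
  shows "0 \<le> E (star_count j u W)"
  using assms by (simp add: expectation_star_count inj_sum_nonneg p_nonneg)

lemma expectation_star_count_le:
  assumes "u \<in> V" "W \<subseteq> V - {u}"
  shows "E (star_count j u W) \<le> mean_degree u ^ j"
proof -
  have W: "finite W" using assms finite_V by (meson finite_Diff finite_subset)
  have "E (star_count j u W) \<le> (\<Sum>v\<in>W. p {u, v}) ^ j"
    unfolding expectation_star_count[OF assms] by (intro inj_sum_le_power W p_nonneg)
  also have "\<dots> \<le> mean_degree u ^ j"
    unfolding mean_degree_def using assms finite_V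
    by (intro power_mono sum_mono2 sum_nonneg p_nonneg) auto
  finally show ?thesis .
qed

text \<open>The square is not a sum of products over distinct edges, but it is dominated by star
  counts of orders \<open>k\<close> and \<open>2 * k\<close>, whose means are known.\<close>

lemma expectation_star_count_square_le:
  assumes u: "u \<in> V"
  shows "E (\<lambda>f. (star_count k u (V - {u}) f)\<^sup>2) \<le>
    (2 * real k) ^ k * (mean_degree u ^ k + mean_degree u ^ (2 * k))"
proof -
  have "E (\<lambda>f. (star_count k u (V - {u}) f)\<^sup>2) \<le>
      E (\<lambda>f. (2 * real k) ^ k * (star_count k u (V - {u}) f + star_count (2 * k) u (V - {u}) f))"
    unfolding star_count_def
    by (intro integral_mono inj_sum_of_bool_square_le integrable_edges_pmf) (simp add: finite_V)
  also have "\<dots> = (2 * real k) ^ k * (E (star_count k u (V - {u})) + E (star_count (2 * k) u (V - {u})))"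
    by simp
  also have "\<dots> \<le> (2 * real k) ^ k * (mean_degree u ^ k + mean_degree u ^ (2 * k))"
    using u by (intro mult_left_mono add_mono expectation_star_count_le) auto
  finally show ?thesis .
qed

text \<open>Each count splits into stars avoiding the edge \<open>{u, w}\<close> and stars using it.
  Apart from that edge the two centres see disjoint sets of edges, so the covariance equals the
  variance of the edge indicator times \<open>(real k)\<^sup>2\<close> and the two means of stars
  with \<open>k - 1\<close> leaves in \<open>W\<close>.\<close>

lemma covariance_star_count_le:
  assumes u: "u \<in> V" and w: "w \<in> V" and uw: "u \<noteq> w"
  shows "E (\<lambda>f. star_count k u (V - {u}) f * star_count k w (V - {w}) f) -
      E (star_count k u (V - {u})) * E (star_count k w (V - {w})) \<le>
    (real k)\<^sup>2 * (p {u, w} * mean_degree u ^ (k - 1) * mean_degree w ^ (k - 1))"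
proof (cases k)
  case 0
  then show ?thesis by (simp add: star_count_def[abs_def])
next
  case (Suc j)
  define W where "W = V - {u, w}"
  define I where "I = (\<lambda>f. of_bool (f {u, w}) :: real)"
  have W: "finite W" "u \<notin> W" "w \<notin> W" "V - {u} = insert w W" "V - {w} = insert u W"
    "W \<subseteq> V - {u}" "W \<subseteq> V - {w}"
    using finite_V u w uw by (auto simp: W_def)
  have Xu: "star_count k u (V - {u}) f = star_count k u W f + real k * (I f * star_count j u W f)" for f
    unfolding W star_count_def Suc I_def using W by (subst inj_sum_insert) auto
  have Xw: "star_count k w (V - {w}) f = star_count k w W f + real k * (I f * star_count j w W f)" for f
    unfolding W star_count_def Suc I_def using W by (subst inj_sum_insert) (auto simp: insert_commute)
  \<comment> \<open>The only source of correlation: the term with two indicators has mean factor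
    \<open>?p\<close>, against \<open>?p\<^sup>2\<close> in the product of the means; all other
    terms cancel.\<close>
  have I_sq: "I f * I f = I f" for f by (simp add: I_def)
  let ?Eu = "\<lambda>i. E (star_count i u W)" and ?Ew = "\<lambda>i. E (star_count i w W)" and ?p = "p {u, w}"
  have EI: "E I = ?p"
    unfolding I_def by (rule expectation_edge) (use u w uw in \<open>auto simp: pairs_def\<close>)
  let ?Su = "(\<lambda>v. {u, v}) ` W" and ?Sw = "(\<lambda>v. {w, v}) ` W"
  have disj: "?Su \<inter> ?Sw = {}" "{{u, w}} \<inter> (?Su \<union> ?Sw) = {}"
    using W(2,3) uw by (auto simp: doubleton_eq_iff)
  have indep: "E (\<lambda>f. star_count i u W f * star_count i' w W f) = ?Eu i * ?Ew i'" for i i'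
    by (rule expectation_mult_disjoint[OF _ _ disj(1)]) (rule star_count_cong, blast)+
  have indepI: "E (\<lambda>f. I f * (star_count i u W f * star_count i' w W f)) = ?p * (?Eu i * ?Ew i')" for i i'
    unfolding indep[symmetric] EI[symmetric]
  proof (rule expectation_mult_disjoint[OF _ _ disj(2)])
    fix f f' :: "'a set \<Rightarrow> bool" assume *: "\<And>e. e \<in> ?Su \<union> ?Sw \<Longrightarrow> f e = f' e"
    have "star_count i u W f = star_count i u W f'" "star_count i' w W f = star_count i' w W f'"
      by (rule star_count_cong, use * in blast)+
    then show "star_count i u W f * star_count i' w W f = star_count i u W f' * star_count i' w W f'"
      by simp
  qed (simp add: I_def)
  \<comment> \<open>Setting one index to 0 turns that star count into the constant 1.\<close>
  have indep1: "E (\<lambda>f. I f * star_count i u W f) = ?p * ?Eu i"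
    "E (\<lambda>f. I f * star_count i w W f) = ?p * ?Ew i" for i
    using indepI[of i 0] indepI[of 0 i] by (simp_all add: star_count_def[abs_def])
  have "E (\<lambda>f. star_count k u (V - {u}) f * star_count k w (V - {w}) f) =
      E (\<lambda>f. star_count k u W f * star_count k w W f
        + real k * (I f * (star_count k u W f * star_count j w W f))
        + real k * (I f * (star_count j u W f * star_count k w W f))
        + (real k)\<^sup>2 * ((I f * I f) * (star_count j u W f * star_count j w W f)))"
    unfolding Xu Xw by (intro Bochner_Integration.integral_cong refl) (simp add: algebra_simps power2_eq_square)
  also have "\<dots> = ?Eu k * ?Ew k + real k * (?p * (?Eu k * ?Ew j)) + real k * (?p * (?Eu j * ?Ew k))
      + (real k)\<^sup>2 * (?p * (?Eu j * ?Ew j))"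
    unfolding I_sq by (simp add: indep indepI)
  finally have 1: "E (\<lambda>f. star_count k u (V - {u}) f * star_count k w (V - {w}) f) = \<dots>" .
  have 2: "E (star_count k u (V - {u})) = ?Eu k + real k * (?p * ?Eu j)"
    "E (star_count k w (V - {w})) = ?Ew k + real k * (?p * ?Ew j)"
    by (simp_all add: ext[OF Xu] ext[OF Xw] indep1)
  have "E (\<lambda>f. star_count k u (V - {u}) f * star_count k w (V - {w}) f) -
      E (star_count k u (V - {u})) * E (star_count k w (V - {w})) =
      (real k)\<^sup>2 * ((?p - ?p\<^sup>2) * (?Eu j * ?Ew j))"
    unfolding 1 2 by (simp add: algebra_simps power2_eq_square)
  also have "\<dots> \<le> (real k)\<^sup>2 * (?p * (mean_degree u ^ j * mean_degree w ^ j))"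
    using u w W p_nonneg[of "{u, w}"]
    by (intro mult_left_mono mult_mono expectation_star_count_le)
      (auto intro!: mult_nonneg_nonneg expectation_star_count_nonneg mean_degree_nonneg zero_le_power)
  finally show ?thesis by (simp add: Suc mult.assoc)
qed

section \<open>Mean and variance of the total number of stars\<close>

definition total_stars :: "nat \<Rightarrow> ('a set \<Rightarrow> bool) \<Rightarrow> real" where
  "total_stars k f = (\<Sum>u\<in>V. star_count k u (V - {u}) f)"

lemma expectation_total_stars_eq_sum:
  "E (total_stars k) = (\<Sum>u\<in>V. E (star_count k u (V - {u})))"
  unfolding total_stars_def[abs_def]
  by (rule Bochner_Integration.integral_sum) (rule integrable_edges_pmf)

lemma expectation_total_stars:
  "E (total_stars k) = (\<Sum>u\<in>V. inj_sum (\<lambda>v. p {u, v}) k (V - {u}))"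
  unfolding expectation_total_stars_eq_sum by (intro sum.cong refl expectation_star_count) auto

lemma expectation_total_stars_le: "E (total_stars k) \<le> (\<Sum>u\<in>V. mean_degree u ^ k)"
  unfolding expectation_total_stars_eq_sum by (intro sum_mono expectation_star_count_le) auto

lemma variance_total_stars_le:
  "measure_pmf.variance edges_pmf (total_stars k) \<le>
    (2 * real k) ^ k * (\<Sum>u\<in>V. mean_degree u ^ k + mean_degree u ^ (2 * k)) +
    (real k)\<^sup>2 * (\<Sum>u\<in>V. \<Sum>w\<in>V - {u}. p {u, w} * mean_degree u ^ (k - 1) * mean_degree w ^ (k - 1))"
proof -
  let ?X = "\<lambda>u. star_count k u (V - {u})"
  let ?c = "\<lambda>u w. E (\<lambda>f. ?X u f * ?X w f) - E (?X u) * E (?X w)"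
  have "measure_pmf.variance edges_pmf (total_stars k) =
      E (\<lambda>f. (total_stars k f)\<^sup>2) - (E (total_stars k))\<^sup>2"
    by (rule measure_pmf.variance_eq[of edges_pmf "total_stars k"]) (rule integrable_edges_pmf)+
  also have "\<dots> = (\<Sum>u\<in>V. \<Sum>w\<in>V. ?c u w)"
    unfolding expectation_total_stars_eq_sum power2_eq_square sum_product
    unfolding total_stars_def sum_product
    by (simp add: sum_subtractf)
  also have "\<dots> = (\<Sum>u\<in>V. ?c u u + (\<Sum>w\<in>V - {u}. ?c u w))"
    by (intro sum.cong refl sum.remove finite_V)
  also have "\<dots> \<le> (\<Sum>u\<in>V. (2 * real k) ^ k * (mean_degree u ^ k + mean_degree u ^ (2 * k)) +
      (\<Sum>w\<in>V - {u}. (real k)\<^sup>2 * (p {u, w} * mean_degree u ^ (k - 1) * mean_degree w ^ (k - 1))))"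
  proof (intro sum_mono add_mono)
    fix u assume u: "u \<in> V"
    \<comment> \<open>On the diagonal the squared mean is simply discarded.\<close>
    have "?c u u \<le> E (\<lambda>f. (?X u f)\<^sup>2)" by (simp add: power2_eq_square)
    also note expectation_star_count_square_le[OF u, of k]
    finally show "?c u u \<le> (2 * real k) ^ k * (mean_degree u ^ k + mean_degree u ^ (2 * k))" .
    fix w assume "w \<in> V - {u}"
    then show "?c u w \<le> (real k)\<^sup>2 * (p {u, w} * mean_degree u ^ (k - 1) * mean_degree w ^ (k - 1))"
      using u by (intro covariance_star_count_le) auto
  qed
  finally show ?thesis by (simp only: sum.distrib distrib_left sum_distrib_left)
qed

end

subsection \<open>Stochastic Kronecker graphs\<close>

text \<open>Summing a product over digits factorises digit by digit; every \<open>n\<close>-th power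
  in the moment bounds arises this way.\<close>

lemma sum_kron_vertices:
  fixes g :: "nat \<Rightarrow> nat \<Rightarrow> real"
  shows "(\<Sum>u\<in>kron_vertices n. \<Prod>i=1..n. g i (u i)) = (\<Prod>i=1..n. g i 0 + g i 1)"
proof -
  have "(\<Prod>i=1..n. \<Sum>y\<in>{0, 1}. g i y) = (\<Sum>u\<in>kron_vertices n. \<Prod>i=1..n. g i (u i))"
    unfolding kron_vertices_def by (rule prod_sum_PiE) auto
  then show ?thesis by simp
qed

lemma kron_vertex_cases: "u \<in> kron_vertices n \<Longrightarrow> i \<in> {1..n} \<Longrightarrow> u i = 0 \<or> u i = 1"
  unfolding kron_vertices_def by (drule (1) PiE_mem) simp

lemma doubleton_in_kron_pairs_iff:
  "{u, v} \<in> kron_pairs n \<longleftrightarrow> u \<in> kron_vertices n \<and> v \<in> kron_vertices n \<and> u \<noteq> v"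
  by (auto simp: kron_pairs_def doubleton_eq_iff)

lemma finite_kron_vertices: "finite (kron_vertices n)"
  unfolding kron_vertices_def by (intro finite_PiE) auto

locale kronecker =
  fixes \<alpha> \<beta> \<gamma> :: real and n :: nat
  assumes params: "0 < \<alpha>" "\<alpha> < 1" "0 < \<beta>" "\<beta> < 1" "0 < \<gamma>" "\<gamma> < 1"
begin

abbreviation P :: "nat \<Rightarrow> nat \<Rightarrow> real" where "P \<equiv> kron_matrix \<alpha> \<beta> \<gamma>"

text \<open>Outside \<open>kron_pairs n\<close> the description in \<open>kron_pair_prob\<close> need not be a probability.\<close>

definition edge_prob :: "(nat \<Rightarrow> nat) set \<Rightarrow> real" where
  "edge_prob e = (if e \<in> kron_pairs n then kron_pair_prob P n e else 0)"

definition row_sum :: "nat \<Rightarrow> real" where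
  "row_sum x = P x 0 + P x 1"

text \<open>This is the expected degree of \<open>u\<close> with a loop at \<open>u\<close> included
  (\<open>sum_kron_prob\<close>). Unlike \<open>mean_degree\<close> it is a product over digits, so
  sums of its powers factorise.\<close>

definition kron_degree :: "(nat \<Rightarrow> nat) \<Rightarrow> real" where
  "kron_degree u = (\<Prod>i=1..n. row_sum (u i))"

lemma P_bounds: "0 < P x y" "P x y < 1"
  using params by (auto simp: kron_matrix_def)

lemma row_sum_simps: "row_sum 0 = \<beta> + \<gamma>" "row_sum (Suc 0) = \<alpha> + \<beta>"
  by (simp_all add: row_sum_def kron_matrix_def)

lemma row_sum_pos: "0 < row_sum x"
  using P_bounds by (simp add: row_sum_def add_pos_pos)

lemma kron_prob_bounds: "0 \<le> kron_prob P n u v" "kron_prob P n u v \<le> 1"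
  unfolding kron_prob_def using P_bounds by (auto intro!: prod_nonneg prod_le_1 intro: less_imp_le)

lemma edge_prob_eq:
  assumes "u \<in> kron_vertices n" "v \<in> kron_vertices n" "u \<noteq> v"
  shows "edge_prob {u, v} = kron_prob P n u v"
  using assms kron_pair_prob_eq[of P n u v] kron_matrix_sym
  by (simp add: edge_prob_def doubleton_in_kron_pairs_iff)

sublocale bernoulli_graph "kron_vertices n" edge_prob
proof
  show "finite (kron_vertices n)" by (rule finite_kron_vertices)
  have *: "edge_prob e = 0 \<or> (\<exists>u v. edge_prob e = kron_prob P n u v)" for e
  proof (cases "e \<in> kron_pairs n")
    case True
    then obtain u v where "e = {u, v}" "u \<in> kron_vertices n" "v \<in> kron_vertices n" "u \<noteq> v"
      by (auto simp: kron_pairs_def)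
    then show ?thesis using edge_prob_eq by blast
  qed (simp add: edge_prob_def)
  show "0 \<le> edge_prob e" "edge_prob e \<le> 1" for e
    using *[of e] kron_prob_bounds by auto
qed

lemma pairs_eq: "pairs = kron_pairs n"
  by (simp add: pairs_def kron_pairs_def)

lemma kronecker_graph_eq:
  "kronecker_graph n P = map_pmf (\<lambda>f. (kron_vertices n, {e \<in> kron_pairs n. f e})) edges_pmf"
  unfolding kronecker_graph_def edges_pmf_def pairs_eq
  by (intro arg_cong[where f = "map_pmf _"] Pi_pmf_cong refl) (simp add: edge_prob_def)

lemma card_star_copies_eq_total_stars:
  "real (card (labeled_copies (star_graph k) (kron_vertices n, {e \<in> kron_pairs n. f e}))) = total_stars k f"
  unfolding card_star_copies[OF finite_kron_vertices] total_stars_def star_count_def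
  by (intro sum.cong refl inj_sum_cong) (auto simp: doubleton_in_kron_pairs_iff)

lemma sum_kron_prob: "(\<Sum>v\<in>kron_vertices n. kron_prob P n u v) = kron_degree u"
  unfolding kron_prob_def kron_degree_def row_sum_def by (rule sum_kron_vertices)

lemma mean_degree_eq:
  assumes "u \<in> kron_vertices n"
  shows "mean_degree u = kron_degree u - kron_prob P n u u"
proof -
  have "mean_degree u = (\<Sum>v\<in>kron_vertices n - {u}. kron_prob P n u v)"
    unfolding mean_degree_def using assms by (intro sum.cong) (auto intro!: edge_prob_eq)
  then show ?thesis
    using assms finite_kron_vertices by (simp add: sum_diff1 sum_kron_prob)
qed

lemma kron_degree_nonneg: "0 \<le> kron_degree u"
  unfolding kron_degree_def by (intro prod_nonneg less_imp_le row_sum_pos)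

lemma mean_degree_le: "u \<in> kron_vertices n \<Longrightarrow> mean_degree u \<le> kron_degree u"
  using mean_degree_eq kron_prob_bounds by simp

lemma sum_kron_degree_power:
  "(\<Sum>u\<in>kron_vertices n. kron_degree u ^ j) = ((\<alpha> + \<beta>) ^ j + (\<beta> + \<gamma>) ^ j) ^ n"
  unfolding kron_degree_def prod_power_distrib
  by (subst sum_kron_vertices) (simp add: row_sum_simps add.commute)

lemma sum_mean_degree_power_le:
  "(\<Sum>u\<in>kron_vertices n. mean_degree u ^ j) \<le> ((\<alpha> + \<beta>) ^ j + (\<beta> + \<gamma>) ^ j) ^ n"
  unfolding sum_kron_degree_power[symmetric]
  by (intro sum_mono power_mono mean_degree_le mean_degree_nonneg)

text \<open>The one-digit factor of \<open>sum_joint_degrees\<close>: the sum over digits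
  \<open>x\<close>, \<open>y\<close> of
  \<open>P x y * row_sum x ^ j * row_sum y ^ j\<close>.\<close>

definition joint_weight :: "nat \<Rightarrow> real" where
  "joint_weight j = \<alpha> * (\<alpha> + \<beta>) ^ (2 * j) + 2 * \<beta> * ((\<alpha> + \<beta>) ^ j * (\<beta> + \<gamma>) ^ j) + \<gamma> * (\<beta> + \<gamma>) ^ (2 * j)"

lemma sum_joint_degrees:
  "(\<Sum>u\<in>kron_vertices n. \<Sum>w\<in>kron_vertices n.
      kron_prob P n u w * kron_degree u ^ j * kron_degree w ^ j) = joint_weight j ^ n"
proof -
  define g where "g = (\<lambda>x. \<Sum>y\<in>{0, 1}. P x y * row_sum x ^ j * row_sum y ^ j)"
  have "(\<Sum>w\<in>kron_vertices n. kron_prob P n u w * kron_degree u ^ j * kron_degree w ^ j) =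
      (\<Prod>i=1..n. g (u i))" for u
  proof -
    have "(\<Sum>w\<in>kron_vertices n. kron_prob P n u w * kron_degree u ^ j * kron_degree w ^ j) =
        (\<Sum>w\<in>kron_vertices n. \<Prod>i=1..n. P (u i) (w i) * row_sum (u i) ^ j * row_sum (w i) ^ j)"
      by (simp add: kron_prob_def kron_degree_def prod_power_distrib prod.distrib)
    also have "\<dots> = (\<Prod>i=1..n. g (u i))"
      unfolding g_def by (subst sum_kron_vertices) simp
    finally show ?thesis .
  qed
  then have "(\<Sum>u\<in>kron_vertices n. \<Sum>w\<in>kron_vertices n.
      kron_prob P n u w * kron_degree u ^ j * kron_degree w ^ j) = (g 0 + g 1) ^ n"
    using sum_kron_vertices[of "\<lambda>_. g" n] by simp
  also have "g 0 + g 1 = joint_weight j"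
    unfolding g_def joint_weight_def power_even_eq power2_eq_square
    by (simp add: row_sum_simps kron_matrix_def mult_ac)
  finally show ?thesis .
qed

text \<open>Replacing \<open>mean_degree\<close> by \<open>kron_degree\<close> and adding the
  diagonal terms \<open>w = u\<close> only increases the bound and makes each sum factorise over
  digits.\<close>

lemma variance_le:
  "measure_pmf.variance edges_pmf (total_stars k) \<le>
    (2 * real k) ^ k * (((\<alpha> + \<beta>) ^ k + (\<beta> + \<gamma>) ^ k) ^ n + ((\<alpha> + \<beta>) ^ (2 * k) + (\<beta> + \<gamma>) ^ (2 * k)) ^ n)
    + (real k)\<^sup>2 * joint_weight (k - 1) ^ n"
proof -
  let ?V = "kron_vertices n"
  have "(\<Sum>u\<in>?V. \<Sum>w\<in>?V - {u}. edge_prob {u, w} * mean_degree u ^ (k - 1) * mean_degree w ^ (k - 1)) \<le>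
      (\<Sum>u\<in>?V. \<Sum>w\<in>?V - {u}. kron_prob P n u w * kron_degree u ^ (k - 1) * kron_degree w ^ (k - 1))"
    by (intro sum_mono mult_mono power_mono)
      (auto simp: edge_prob_eq mean_degree_le mean_degree_nonneg kron_degree_nonneg kron_prob_bounds)
  also have "\<dots> \<le> (\<Sum>u\<in>?V. \<Sum>w\<in>?V. kron_prob P n u w * kron_degree u ^ (k - 1) * kron_degree w ^ (k - 1))"
    by (intro sum_mono sum_mono2 mult_nonneg_nonneg zero_le_power kron_degree_nonneg kron_prob_bounds
        finite_kron_vertices) auto
  also have "\<dots> = joint_weight (k - 1) ^ n" by (rule sum_joint_degrees)
  finally have 1: "(\<Sum>u\<in>?V. \<Sum>w\<in>?V - {u}. edge_prob {u, w} * mean_degree u ^ (k - 1) * mean_degree w ^ (k - 1))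
      \<le> joint_weight (k - 1) ^ n" .
  have 2: "(\<Sum>u\<in>?V. mean_degree u ^ k + mean_degree u ^ (2 * k)) \<le>
      ((\<alpha> + \<beta>) ^ k + (\<beta> + \<gamma>) ^ k) ^ n + ((\<alpha> + \<beta>) ^ (2 * k) + (\<beta> + \<gamma>) ^ (2 * k)) ^ n"
    unfolding sum.distrib by (intro add_mono sum_mean_degree_power_le)
  show ?thesis
    by (rule order_trans[OF variance_total_stars_le])
      (intro add_mono mult_left_mono 1 2; simp)
qed

text \<open>Each entry of \<open>P\<close> is at most \<open>shrink\<close> times its row sum: the other entry of the row is at
  least \<open>min \<alpha> (min \<beta> \<gamma>)\<close> and the row sum is at most 2.\<close>

definition shrink :: real where
  "shrink = 1 - min \<alpha> (min \<beta> \<gamma>) / 2"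

lemma shrink_bounds: "0 < shrink" "shrink < 1"
  using params by (auto simp: shrink_def)

lemma P_le_shrink:
  assumes "x \<in> {0, 1}" "y \<in> {0, 1}"
  shows "P x y \<le> shrink * row_sum x"
proof -
  let ?\<mu> = "min \<alpha> (min \<beta> \<gamma>)"
  have "row_sum x \<le> 2" using P_bounds(2)[of x 0] P_bounds(2)[of x 1] by (simp add: row_sum_def)
  then have "?\<mu> * row_sum x \<le> ?\<mu> * 2" using params by (intro mult_left_mono) auto
  moreover have "?\<mu> \<le> P x (1 - y)" by (auto simp: kron_matrix_def)
  moreover have "P x y + P x (1 - y) = row_sum x" using assms by (auto simp: row_sum_def)
  ultimately show ?thesis by (simp add: shrink_def algebra_simps)
qed

lemma kron_prob_le_shrink:
  assumes "u \<in> kron_vertices n" "v \<in> kron_vertices n"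
  shows "kron_prob P n u v \<le> shrink ^ n * kron_degree u"
proof -
  have "kron_prob P n u v \<le> (\<Prod>i=1..n. shrink * row_sum (u i))"
    unfolding kron_prob_def
    using kron_vertex_cases[OF assms(1)] kron_vertex_cases[OF assms(2)] P_bounds(1)
    by (intro prod_mono conjI P_le_shrink less_imp_le) auto
  then show ?thesis by (simp add: prod.distrib kron_degree_def)
qed

lemma expectation_le: "E (total_stars k) \<le> ((\<alpha> + \<beta>) ^ k + (\<beta> + \<gamma>) ^ k) ^ n"
  by (rule order_trans[OF expectation_total_stars_le sum_mean_degree_power_le])

lemma expectation_ge:
  assumes "real (Suc k) * shrink ^ n \<le> 1"
  shows "(1 - real (Suc k) * shrink ^ n) ^ k * ((\<alpha> + \<beta>) ^ k + (\<beta> + \<gamma>) ^ k) ^ n \<le> E (total_stars k)"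
proof -
  let ?c = "1 - real (Suc k) * shrink ^ n"
  have "?c ^ k * kron_degree u ^ k \<le> inj_sum (\<lambda>v. edge_prob {u, v}) k (kron_vertices n - {u})"
    if u: "u \<in> kron_vertices n" for u
  proof -
    let ?m = "shrink ^ n * kron_degree u" and ?W = "kron_vertices n - {u}"
    have m: "0 \<le> ?m" using shrink_bounds kron_degree_nonneg by simp
    have s: "kron_degree u - ?m \<le> mean_degree u"
      using u kron_prob_le_shrink[OF u u] by (simp add: mean_degree_eq)
    \<comment> \<open>Of the \<open>Suc k\<close> copies of \<open>?m\<close>, one pays for the
      missing loop at \<open>u\<close> and \<open>k\<close> pay for the distinctness of the leaves
      in \<open>inj_sum_ge_power\<close>.\<close>
    have c: "?c * kron_degree u = kron_degree u - ?m - real k * ?m" by (simp add: algebra_simps)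
    have c0: "0 \<le> ?c * kron_degree u" using assms kron_degree_nonneg by (intro mult_nonneg_nonneg) auto
    have "?c ^ k * kron_degree u ^ k \<le> (mean_degree u - real k * ?m) ^ k"
      unfolding power_mult_distrib[symmetric] using c c0 s by (intro power_mono) linarith+
    also have "\<dots> \<le> inj_sum (\<lambda>v. edge_prob {u, v}) k ?W"
      unfolding mean_degree_def
    proof (rule inj_sum_ge_power)
      show "real k * ?m \<le> (\<Sum>v\<in>?W. edge_prob {u, v})"
        using c c0 s by (simp add: mean_degree_def)
      show "edge_prob {u, v} \<le> ?m" if "v \<in> ?W" for v
        using that u kron_prob_le_shrink[of u v] edge_prob_eq[of u v] by auto
    qed (auto simp: finite_kron_vertices p_nonneg m)
    finally show ?thesis .
  qed
  then show ?thesis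
    unfolding expectation_total_stars sum_kron_degree_power[symmetric] sum_distrib_left
    by (intro sum_mono)
qed

section \<open>Probability bounds from the first and second moments\<close>

lemma prob_copies_le:
  "measure_pmf.prob (kronecker_graph n P) {H. labeled_copies (star_graph k) H \<noteq> {}} \<le>
    ((\<alpha> + \<beta>) ^ k + (\<beta> + \<gamma>) ^ k) ^ n"
proof -
  let ?H = "\<lambda>f. (kron_vertices n, {e \<in> kron_pairs n. f e})"
  have nonneg: "0 \<le> total_stars k f" for f
    using card_star_copies_eq_total_stars[of k f] by (metis of_nat_0_le_iff)
  have "measure_pmf.prob (kronecker_graph n P) {H. labeled_copies (star_graph k) H \<noteq> {}} =
      measure_pmf.prob edges_pmf {f. labeled_copies (star_graph k) (?H f) \<noteq> {}}"
    by (simp add: kronecker_graph_eq vimage_def)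
  also have "\<dots> \<le> measure_pmf.prob edges_pmf {f \<in> space (measure_pmf edges_pmf). 1 \<le> total_stars k f}"
  proof (intro measure_pmf.finite_measure_mono subsetI)
    fix f assume "f \<in> {f. labeled_copies (star_graph k) (?H f) \<noteq> {}}"
    \<comment> \<open>Finiteness matters because \<open>card\<close> is 0 on infinite sets.\<close>
    moreover have "finite (labeled_copies (star_graph k) (?H f))"
      by (auto simp: labeled_copies_def star_graph_def finite_kron_vertices
          intro!: finite_PiE finite_Collect_conjI)
    ultimately have "card (labeled_copies (star_graph k) (?H f)) \<ge> 1"
      by (simp add: Suc_le_eq card_gt_0_iff)
    then show "f \<in> {f \<in> space (measure_pmf edges_pmf). 1 \<le> total_stars k f}"
      using card_star_copies_eq_total_stars[of k f] by simp
  qed simp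
  also have "\<dots> \<le> E (total_stars k) / 1"
    by (rule integral_Markov_inequality_measure[where A = "{}"]) (auto simp: nonneg)
  also have "\<dots> \<le> ((\<alpha> + \<beta>) ^ k + (\<beta> + \<gamma>) ^ k) ^ n"
    using expectation_le by simp
  finally show ?thesis .
qed

text \<open>The tolerance has two parts: \<open>1 - (1 - real (Suc k) * shrink ^ n) ^ k\<close>
  covers the gap between the mean and its upper bound, and \<open>z\<close> is left for the
  fluctuation around the mean, controlled by Chebyshev's inequality.\<close>

lemma prob_deviation_le:
  assumes k: "real (Suc k) * shrink ^ n \<le> 1" and z: "0 < z"
  shows "measure_pmf.prob (kronecker_graph n P)
      {H. \<not> \<bar>real (card (labeled_copies (star_graph k) H)) - ((\<alpha> + \<beta>) ^ k + (\<beta> + \<gamma>) ^ k) ^ n\<bar> \<le>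
        (1 - (1 - real (Suc k) * shrink ^ n) ^ k + z) * ((\<alpha> + \<beta>) ^ k + (\<beta> + \<gamma>) ^ k) ^ n} \<le>
    ((2 * real k) ^ k * (((\<alpha> + \<beta>) ^ k + (\<beta> + \<gamma>) ^ k) ^ n + ((\<alpha> + \<beta>) ^ (2 * k) + (\<beta> + \<gamma>) ^ (2 * k)) ^ n)
      + (real k)\<^sup>2 * joint_weight (k - 1) ^ n) / (z * ((\<alpha> + \<beta>) ^ k + (\<beta> + \<gamma>) ^ k) ^ n)\<^sup>2"
    (is "measure_pmf.prob _ {H. \<not> ?Q H} \<le> _")
proof -
  let ?H = "\<lambda>f. (kron_vertices n, {e \<in> kron_pairs n. f e})"
  let ?S = "((\<alpha> + \<beta>) ^ k + (\<beta> + \<gamma>) ^ k) ^ n"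
  have S: "0 < ?S" using params by (intro zero_less_power add_pos_pos) auto
  have "measure_pmf.prob (kronecker_graph n P) {H. \<not> ?Q H} = measure_pmf.prob edges_pmf {f. \<not> ?Q (?H f)}"
    by (simp add: kronecker_graph_eq vimage_def)
  also have "\<dots> \<le> measure_pmf.prob edges_pmf
      {f \<in> space (measure_pmf edges_pmf). \<bar>total_stars k f - E (total_stars k)\<bar> \<ge> z * ?S}"
  proof (intro measure_pmf.finite_measure_mono subsetI)
    fix f assume "f \<in> {f. \<not> ?Q (?H f)}"
    then have "\<not> \<bar>total_stars k f - ?S\<bar> \<le> (1 - (1 - real (Suc k) * shrink ^ n) ^ k + z) * ?S"
      by (simp only: card_star_copies_eq_total_stars mem_Collect_eq not_False_eq_True)
    moreover have "(1 - (1 - real (Suc k) * shrink ^ n) ^ k + z) * ?S =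
        ?S - (1 - real (Suc k) * shrink ^ n) ^ k * ?S + z * ?S"
      by (simp add: algebra_simps)
    ultimately have "z * ?S \<le> \<bar>total_stars k f - E (total_stars k)\<bar>"
      using expectation_le[of k] expectation_ge[OF k] by linarith
    then show "f \<in> {f \<in> space (measure_pmf edges_pmf). \<bar>total_stars k f - E (total_stars k)\<bar> \<ge> z * ?S}"
      by simp
  qed simp
  also have "\<dots> \<le> measure_pmf.variance edges_pmf (total_stars k) / (z * ?S)\<^sup>2"
    by (rule measure_pmf.Chebyshev_inequality) (use z S in auto)
  also note divide_right_mono[OF variance_le zero_le_power2]
  finally show ?thesis .
qed

lemma joint_weight_less:
  assumes S: "(\<alpha> + \<beta>) ^ k + (\<beta> + \<gamma>) ^ k > 1"
  shows "0 \<le> joint_weight (k - 1)" "joint_weight (k - 1) < ((\<alpha> + \<beta>) ^ k + (\<beta> + \<gamma>) ^ k)\<^sup>2"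
proof -
  define a b where "a = \<alpha> + \<beta>" and "b = \<beta> + \<gamma>"
  have ab: "0 < a" "0 < b" using params by (auto simp: a_def b_def)
  show "0 \<le> joint_weight (k - 1)"
    unfolding joint_weight_def using params by (intro add_nonneg_nonneg mult_nonneg_nonneg) auto
  show "joint_weight (k - 1) < ((\<alpha> + \<beta>) ^ k + (\<beta> + \<gamma>) ^ k)\<^sup>2"
  proof (cases k)
    \<comment> \<open>Here \<open>k - 1\<close> is 0, and the claim reads \<alpha> + 2 \<beta> +
      \<gamma> < 4.\<close>
    case 0
    then show ?thesis using params by (simp add: joint_weight_def)
  next
    case (Suc j)
    let ?S = "a ^ k + b ^ k"
    \<comment> \<open>Bounding the mixed term by squares lets \<beta> join \<alpha> and \<gamma>,
      forming the full row sums \<open>a\<close> and \<open>b\<close>.\<close>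
    have "2 * (a ^ j * b ^ j) \<le> (a ^ j)\<^sup>2 + (b ^ j)\<^sup>2"
      using sum_squares_bound[of "a ^ j" "b ^ j"] by simp
    then have "\<beta> * (2 * (a ^ j * b ^ j)) \<le> \<beta> * ((a ^ j)\<^sup>2 + (b ^ j)\<^sup>2)"
      using params by (intro mult_left_mono) auto
    then have "joint_weight j \<le> \<alpha> * (a ^ j)\<^sup>2 + \<beta> * ((a ^ j)\<^sup>2 + (b ^ j)\<^sup>2) + \<gamma> * (b ^ j)\<^sup>2"
      unfolding joint_weight_def a_def[symmetric] b_def[symmetric]
      by (simp add: power_mult[symmetric] mult.commute mult.left_commute)
    also have "\<dots> = a ^ k * a ^ j + b ^ k * b ^ j"
      unfolding Suc by (simp add: a_def b_def algebra_simps power2_eq_square)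
    also have "\<dots> < a ^ k * ?S + b ^ k * ?S"
    proof -
      \<comment> \<open>The exponent \<open>j = k - 1\<close> is compared with 0 or \<open>k\<close>
        according to the size of \<open>x\<close>. The bound 1 stays below \<open>?S\<close> by the
        hypothesis \<open>S\<close>.\<close>
      have "x ^ j \<le> max 1 (x ^ k)" if "0 < x" for x :: real
      proof (cases "x \<le> 1")
        case True
        then show ?thesis using that by (simp add: power_le_one le_max_iff_disj)
      next
        case False
        then show ?thesis using Suc by (intro max.coboundedI2 power_increasing) auto
      qed
      moreover have "max 1 (a ^ k) < ?S" "max 1 (b ^ k) < ?S"
        using S ab by (auto simp: a_def b_def)
      ultimately have "a ^ j < ?S" "b ^ j < ?S" using ab by (meson order_le_less_trans)+
      then show ?thesis using ab by (intro add_strict_mono mult_strict_left_mono) auto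
    qed
    also have "\<dots> = ?S\<^sup>2" by (simp add: power2_eq_square algebra_simps)
    finally show ?thesis by (simp add: Suc a_def b_def)
  qed
qed

end

section \<open>Passage to the limit\<close>

lemma aasI:
  assumes "\<forall>\<^sub>F n in sequentially. measure_pmf.prob (M n) {x. \<not> Q n x} \<le> \<epsilon> n" "\<epsilon> \<longlonglongrightarrow> 0"
  shows "aas M Q"
  unfolding aas_def
proof (rule tendsto_sandwich[of "\<lambda>n. 1 - \<epsilon> n" _ _ "\<lambda>_. 1"])
  have "measure_pmf.prob (M n) {x. Q n x} = 1 - measure_pmf.prob (M n) {x. \<not> Q n x}" for n
    using measure_pmf.prob_compl[of "{x. \<not> Q n x}" "M n"]
    by (simp add: Compl_eq_Diff_UNIV[symmetric] Collect_neg_eq[symmetric])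
  then show "\<forall>\<^sub>F n in sequentially. 1 - \<epsilon> n \<le> measure_pmf.prob (M n) {x. Q n x}"
    using assms(1) by simp
  show "(\<lambda>n. 1 - \<epsilon> n) \<longlonglongrightarrow> 1"
    using tendsto_diff[OF tendsto_const assms(2), of 1] by simp
qed auto

theorem theorem15:
  fixes \<alpha> \<beta> \<gamma> :: real and k :: nat
  assumes "0 < \<alpha>" "\<alpha> < 1" "0 < \<beta>" "\<beta> < 1" "0 < \<gamma>" "\<gamma> < 1"
  shows "((\<alpha> + \<beta>) ^ k + (\<beta> + \<gamma>) ^ k < 1 \<longrightarrow>
            aas (\<lambda>n. kronecker_graph n (kron_matrix \<alpha> \<beta> \<gamma>))
                (\<lambda>n H. labeled_copies (star_graph k) H = {}))
       \<and> ((\<alpha> + \<beta>) ^ k + (\<beta> + \<gamma>) ^ k > 1 \<longrightarrow>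
            aas_asymp (\<lambda>n. kronecker_graph n (kron_matrix \<alpha> \<beta> \<gamma>))
                (\<lambda>n H. real (card (labeled_copies (star_graph k) H)))
                (\<lambda>n. ((\<alpha> + \<beta>) ^ k + (\<beta> + \<gamma>) ^ k) ^ n))"
proof (intro conjI impI)
  \<comment> \<open>The interpretation is uniform in \<open>n\<close>; \<open>shrink\<close> and
    \<open>joint_weight\<close> do not involve \<open>n\<close>, so they serve as constants in the
    limits below.\<close>
  interpret kronecker \<alpha> \<beta> \<gamma> n for n
    using assms by unfold_locales
  define S where "S = (\<alpha> + \<beta>) ^ k + (\<beta> + \<gamma>) ^ k"
  have pos: "0 < (\<alpha> + \<beta>) ^ j" "0 < (\<beta> + \<gamma>) ^ j" for j
    using assms by auto
  have S_pos: "0 < S" using pos by (simp add: S_def add_pos_pos)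
  {
    assume "(\<alpha> + \<beta>) ^ k + (\<beta> + \<gamma>) ^ k < 1"
    then have "(\<lambda>n. S ^ n) \<longlonglongrightarrow> 0" using S_pos by (intro LIMSEQ_realpow_zero) (auto simp: S_def)
    then show "aas (\<lambda>n. kronecker_graph n (kron_matrix \<alpha> \<beta> \<gamma>)) (\<lambda>n H. labeled_copies (star_graph k) H = {})"
      by (intro aasI[where \<epsilon> = "\<lambda>n. S ^ n"] always_eventually allI) (simp_all only: S_def prob_copies_le)
  next
    assume "(\<alpha> + \<beta>) ^ k + (\<beta> + \<gamma>) ^ k > 1"
    then have S: "1 < S" by (simp add: S_def)
    define D where "D = (\<alpha> + \<beta>) ^ (2 * k) + (\<beta> + \<gamma>) ^ (2 * k)"
    define J where "J = joint_weight (k - 1)"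
    define C where "C = (2 * real k) ^ k"
    \<comment> \<open>The variance bound divided by \<open>S ^ (2 * n)\<close>. The choice of
      \<open>z\<close> as its fourth root makes both \<open>z n\<close> and the Chebyshev bound
      \<open>v n / (z n)\<^sup>2 = sqrt (v n)\<close> tend to 0.\<close>
    define v where "v = (\<lambda>n. C * ((1 / S) ^ n + (D / S\<^sup>2) ^ n) + (real k)\<^sup>2 * (J / S\<^sup>2) ^ n)"
    define z where "z = (\<lambda>n. sqrt (sqrt (v n)))"
    define \<delta> where "\<delta> = (\<lambda>n. 1 - (1 - real (Suc k) * shrink ^ n) ^ k + z n)"
    have J: "0 \<le> J" "J < S\<^sup>2"
      unfolding J_def S_def using joint_weight_less S by (simp_all add: S_def)
    have "0 < D" unfolding D_def by (intro add_pos_pos pos)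
    moreover have "D < S\<^sup>2" using pos by (simp add: D_def S_def power_even_eq power2_sum)
    ultimately have D: "0 < D" "D < S\<^sup>2" .
    \<comment> \<open>For \<open>k = 0\<close> this is \<open>0 ^ 0 = 1\<close>. Positivity of
      \<open>C\<close> makes \<open>z n\<close> positive, as \<open>prob_deviation_le\<close>
      requires.\<close>
    have C: "0 < C" by (cases k) (auto simp: C_def)
    have v_pos: "0 < v n" for n
      unfolding v_def using C D J S by (intro add_pos_nonneg mult_pos_pos add_pos_pos mult_nonneg_nonneg) auto
    then have z_pos: "0 < z n" for n by (simp add: z_def)
    have "v \<longlonglongrightarrow> C * (0 + 0) + (real k)\<^sup>2 * 0"
      unfolding v_def using S D J
      by (intro tendsto_intros LIMSEQ_realpow_zero) (auto simp: divide_simps)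
    then have v_lim: "v \<longlonglongrightarrow> 0" by simp
    have z_lim: "z \<longlonglongrightarrow> 0"
      unfolding z_def using tendsto_real_sqrt[OF tendsto_real_sqrt[OF v_lim]] by simp
    have sh: "(\<lambda>n. real (Suc k) * shrink ^ n) \<longlonglongrightarrow> 0"
      using tendsto_mult_right_zero[OF LIMSEQ_realpow_zero[of shrink], of "real (Suc k)"] shrink_bounds by simp
    have "\<delta> \<longlonglongrightarrow> 1 - (1 - 0) ^ k + 0"
      unfolding \<delta>_def by (intro tendsto_intros sh z_lim)
    then have \<delta>_lim: "\<delta> \<longlonglongrightarrow> 0" by simp
    have "aas (\<lambda>n. kronecker_graph n (kron_matrix \<alpha> \<beta> \<gamma>))
        (\<lambda>n H. \<exists>\<eta>. \<bar>\<eta>\<bar> \<le> \<delta> n \<and> real (card (labeled_copies (star_graph k) H)) = (1 + \<eta>) * S ^ n)"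
    proof (rule aasI)
      show "(\<lambda>n. sqrt (v n)) \<longlonglongrightarrow> 0" using tendsto_real_sqrt[OF v_lim] by simp
      have "\<forall>\<^sub>F n in sequentially. real (Suc k) * shrink ^ n < 1"
        using order_tendstoD(2)[OF sh] by simp
      then show "\<forall>\<^sub>F n in sequentially. measure_pmf.prob (kronecker_graph n (kron_matrix \<alpha> \<beta> \<gamma>))
          {H. \<not> (\<exists>\<eta>. \<bar>\<eta>\<bar> \<le> \<delta> n \<and> real (card (labeled_copies (star_graph k) H)) = (1 + \<eta>) * S ^ n)} \<le> sqrt (v n)"
      proof eventually_elim
        case (elim n)
        let ?X = "\<lambda>H. real (card (labeled_copies (star_graph k) H))"
        have Sn: "0 < S ^ n" using S_pos by simp
        have "measure_pmf.prob (kronecker_graph n (kron_matrix \<alpha> \<beta> \<gamma>))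
            {H. \<not> (\<exists>\<eta>. \<bar>\<eta>\<bar> \<le> \<delta> n \<and> ?X H = (1 + \<eta>) * S ^ n)} \<le>
          measure_pmf.prob (kronecker_graph n (kron_matrix \<alpha> \<beta> \<gamma>)) {H. \<not> \<bar>?X H - S ^ n\<bar> \<le> \<delta> n * S ^ n}"
        proof (intro measure_pmf.finite_measure_mono subsetI CollectI notI)
          fix H assume H: "H \<in> {H. \<not> (\<exists>\<eta>. \<bar>\<eta>\<bar> \<le> \<delta> n \<and> ?X H = (1 + \<eta>) * S ^ n)}"
            and X: "\<bar>?X H - S ^ n\<bar> \<le> \<delta> n * S ^ n"
          \<comment> \<open>The relative error \<open>?X H / S ^ n - 1\<close> is the witness for
            \<eta>.\<close>
          have "\<bar>?X H / S ^ n - 1\<bar> = \<bar>?X H - S ^ n\<bar> / S ^ n"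
            using S_pos by (simp add: abs_divide divide_simps)
          also have "\<dots> \<le> \<delta> n" using X Sn by (simp add: pos_divide_le_eq)
          finally have "\<bar>?X H / S ^ n - 1\<bar> \<le> \<delta> n" .
          moreover have "?X H = (1 + (?X H / S ^ n - 1)) * S ^ n" using S_pos by simp
          ultimately show False using H by blast
        qed simp
        also have "\<dots> \<le> (C * (S ^ n + D ^ n) + (real k)\<^sup>2 * J ^ n) / (z n * S ^ n)\<^sup>2"
          unfolding S_def \<delta>_def C_def D_def J_def
          by (rule prob_deviation_le) (use elim z_pos in auto)
        also have "\<dots> = v n / (z n)\<^sup>2"
          unfolding v_def using S_pos
          by (simp add: power_divide power_mult_distrib power2_eq_square power_mult field_simps)
        also have "\<dots> = sqrt (v n)"
          using v_pos[of n] by (simp add: z_def real_div_sqrt)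
        finally show ?case .
      qed
    qed
    then show "aas_asymp (\<lambda>n. kronecker_graph n (kron_matrix \<alpha> \<beta> \<gamma>))
        (\<lambda>n H. real (card (labeled_copies (star_graph k) H)))
        (\<lambda>n. ((\<alpha> + \<beta>) ^ k + (\<beta> + \<gamma>) ^ k) ^ n)"
      unfolding aas_asymp_def S_def using \<delta>_lim by blast
  }
qed

end
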